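(* Let $\mu$ be the one-dimensional surface measure (arc length measure) on the boundary of the square in $\mathbb{R}^2$ with vertices $(0,0)$, $(1/2,1/2)$, $(1,0)$, $(1/2,-1/2)$, and let $\Lambda = \mathbb{Z}\times\{0\}\subset\mathbb{R}^2$. Then there do not exist a positive integer $N$ and points $t_1,\ldots,t_N\in\mathbb{R}^2$ such that $E\left(\bigcup_{k=1}^N(\Lambda+t_k)\right)$ is a Riesz basis for $L^2(\mu)$.
   Context: For a countable set $S\subset\mathbb{R}^d$, $E(S)=\{e^{2\pi i\lambda\cdot x}:\lambda\in S\}$. For a finite Borel measure $\mu$ on $\mathbb{R}^d$, $E(S)$ is a frame for $L^2(\mu)$ if there are $0<A\le B<\infty$ with $A\int|f|^2d\mu\le\sum_{\lambda\in S}\left|\int f(x)e^{-2\pi i\lambda\cdot x}d\mu(x)\right|^2\le B\int|f|^2d\mu$ for all $f\in L^2(\mu)$. It is a Riesz sequence if there are $0<A\le B<\infty$ with $A\sum_{\lambda\in S}|c_\lambda|^2\le\int\left|\sum_{\lambda\in S}c_\lambda e^{2\pi i\lambda\cdot x}\right|^2d\mu(x)\le B\sum_{\lambda\in S}|c_\lambda|^2$ for all finitely supported families of complex numbers $(c_\lambda)_{\lambda\in S}$. It is a Riesz basis for $L^2(\mu)$ if it is both a frame and a Riesz sequence. *)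

theory Defs
  imports "HOL-Analysis.Analysis"
begin

definition expo :: "'a::euclidean_space \<Rightarrow> 'a \<Rightarrow> complex" where
  "expo l x = exp (2 * of_real pi * \<i> * of_real (l \<bullet> x))"

text \<open>
  The three predicates below speak about the family of exponentials indexed by the frequency
  set \<open>S\<close>. Elements of the square-integrable space are represented by measurable functions.
  In the frame condition the sum takes values in the extended reals and the upper bound forces
  it to be finite; over the reals this is expressed by \<open>summable_on\<close>, as \<open>infsum\<close> of a
  non-summable family is 0.
\<close>

definition exp_frame :: "'a::euclidean_space measure \<Rightarrow> 'a set \<Rightarrow> bool" where
  "exp_frame M S \<longleftrightarrow>
    (\<exists>A B. 0 < A \<and> A \<le> B \<and>
      (\<forall>f :: 'a \<Rightarrow> complex.
        f \<in> borel_measurable M \<longrightarrow> integrable M (\<lambda>x. (cmod (f x))\<^sup>2) \<longrightarrow>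
          (\<lambda>l. (cmod (\<integral>x. f x * expo (- l) x \<partial>M))\<^sup>2) summable_on S \<and>
          A * (\<integral>x. (cmod (f x))\<^sup>2 \<partial>M)
            \<le> (\<Sum>\<^sub>\<infinity>l\<in>S. (cmod (\<integral>x. f x * expo (- l) x \<partial>M))\<^sup>2) \<and>
          (\<Sum>\<^sub>\<infinity>l\<in>S. (cmod (\<integral>x. f x * expo (- l) x \<partial>M))\<^sup>2)
            \<le> B * (\<integral>x. (cmod (f x))\<^sup>2 \<partial>M)))"

text \<open>A finitely supported family on \<open>S\<close> is given by a finite \<open>F \<subseteq> S\<close> containing its support.\<close>

definition exp_riesz_sequence :: "'a::euclidean_space measure \<Rightarrow> 'a set \<Rightarrow> bool" where
  "exp_riesz_sequence M S \<longleftrightarrow>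
    (\<exists>A B. 0 < A \<and> A \<le> B \<and>
      (\<forall>F (c :: 'a \<Rightarrow> complex). finite F \<longrightarrow> F \<subseteq> S \<longrightarrow>
          A * (\<Sum>l\<in>F. (cmod (c l))\<^sup>2)
            \<le> (\<integral>x. (cmod (\<Sum>l\<in>F. c l * expo l x))\<^sup>2 \<partial>M) \<and>
          (\<integral>x. (cmod (\<Sum>l\<in>F. c l * expo l x))\<^sup>2 \<partial>M)
            \<le> B * (\<Sum>l\<in>F. (cmod (c l))\<^sup>2)))"

definition exp_riesz_basis :: "'a::euclidean_space measure \<Rightarrow> 'a set \<Rightarrow> bool" where
  "exp_riesz_basis M S \<longleftrightarrow> exp_frame M S \<and> exp_riesz_sequence M S"

text \<open>
  The arc length measure carried by a piecewise continuously differentiable path \<open>g\<close> is the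
  image of \<open>|g'(t)| dt\<close> on the unit interval. For a simple (closed) path this is the arc length
  measure on the curve \<open>path_image g\<close>. The value of \<open>vector_derivative\<close> at the finitely many
  break points is irrelevant.
\<close>

definition arc_length_measure :: "(real \<Rightarrow> 'a::euclidean_space) \<Rightarrow> 'a measure" where
  "arc_length_measure g =
    distr (density (restrict_space lborel {0..1})
            (\<lambda>t. ennreal (norm (vector_derivative g (at t))))) borel g"

definition square_path :: "real \<Rightarrow> real \<times> real" where
  "square_path =
    (linepath (0, 0) (1/2, 1/2) +++ linepath (1/2, 1/2) (1, 0)) +++
    (linepath (1, 0) (1/2, -1/2) +++ linepath (1/2, -1/2) (0, 0))"

end

theory Submission
  imports Defs
begin

text \<open>
  Not even the lower frame bound can hold. Write \<open>\<mu>\<close> for the arc length measure. Close to the corner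
  \<open>(0, 0)\<close> the two sides of the square lie over the same interval of first coordinates, at the heights
  \<open>x\<close> and \<open>-x\<close>. A character with frequency \<open>(n + a, b)\<close> takes there the values
  \<open>exp (2 \<pi> \<i> ((n + a) x \<plusminus> b x))\<close>, which differ by \<open>O(x)\<close> uniformly in \<open>n\<close>. So every
  character of the coset nearly annihilates the function \<open>f\<close> that is \<open>1\<close> on the upper and \<open>-1\<close> on
  the lower side for \<open>0 < x \<le> 2 \<delta>\<close> and vanishes elsewhere.

  Quantitatively, folding the lower side onto the upper one turns the coefficients of \<open>f\<close> along one
  coset into Fourier coefficients of a function of size \<open>O(\<delta>)\<close> that lives on an interval of length
  \<open>\<delta>\<close> (\<open>corner_jump_coefficient\<close>). By Bessel's inequality the sum of their squares is
  \<open>O(\<delta>\<^sup>3)\<close> (\<open>corner_jump_coset_sum_le\<close>), and the same holds for finitely many cosets together.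
  But \<open>\<integral>\<bar>f\<bar>\<^sup>2 d\<mu>\<close> is proportional to \<open>\<delta>\<close>, so a lower frame bound is violated as soon as \<open>\<delta>\<close> is small.
\<close>

section \<open>Bessel's inequality\<close>

lemma integrable_mult_of_square_integrable:
  fixes f g :: "'a \<Rightarrow> complex"
  assumes [measurable]: "f \<in> borel_measurable M" "g \<in> borel_measurable M"
    and "integrable M (\<lambda>x. (cmod (f x))\<^sup>2)" "integrable M (\<lambda>x. (cmod (g x))\<^sup>2)"
  shows "integrable M (\<lambda>x. f x * g x)"
proof (rule Bochner_Integration.integrable_bound)
  show "integrable M (\<lambda>x. (cmod (f x))\<^sup>2 + (cmod (g x))\<^sup>2)"
    using assms by simp
  have "a * b \<le> a\<^sup>2 + b\<^sup>2" if "a \<ge> 0" "b \<ge> 0" for a b :: real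
    using sum_squares_bound[of a b] mult_nonneg_nonneg[OF that] by linarith
  then show "AE x in M. norm (f x * g x) \<le> norm ((cmod (f x))\<^sup>2 + (cmod (g x))\<^sup>2)"
    by (simp add: norm_mult)
qed measurable

text \<open>
  The proof integrates the nonnegative function \<open>\<bar>f - s\<bar>\<^sup>2\<close>, where \<open>s\<close> is the orthogonal
  projection of \<open>f\<close> to the span of the \<open>e i\<close>.
\<close>

lemma Bessel_inequality:
  fixes f :: "'a \<Rightarrow> complex" and e :: "'i \<Rightarrow> 'a \<Rightarrow> complex"
  assumes "finite J"
    and [measurable]: "f \<in> borel_measurable M" "\<And>i. i \<in> J \<Longrightarrow> e i \<in> borel_measurable M"
    and f: "integrable M (\<lambda>x. (cmod (f x))\<^sup>2)"
    and e: "\<And>i. i \<in> J \<Longrightarrow> integrable M (\<lambda>x. (cmod (e i x))\<^sup>2)"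
    and orth: "\<And>i j. i \<in> J \<Longrightarrow> j \<in> J \<Longrightarrow>
      (\<integral>x. e i x * cnj (e j x) \<partial>M) = (if i = j then 1 else 0)"
  shows "(\<Sum>i\<in>J. (cmod (\<integral>x. f x * cnj (e i x) \<partial>M))\<^sup>2) \<le> (\<integral>x. (cmod (f x))\<^sup>2 \<partial>M)"
proof -
  have [measurable]: "cnj \<in> borel_measurable borel"
    by (intro borel_measurable_continuous_onI continuous_intros)
  define c where "c i = (\<integral>x. f x * cnj (e i x) \<partial>M)" for i
  define s where "s x = (\<Sum>i\<in>J. c i * e i x)" for x
  have int_fe: "integrable M (\<lambda>x. f x * cnj (e i x))" if "i \<in> J" for i
  proof -
    note [measurable] = assms(3)[OF that]
    show ?thesis using f e[OF that] by (intro integrable_mult_of_square_integrable) auto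
  qed
  have int_ef: "integrable M (\<lambda>x. cnj (f x) * e i x)" if "i \<in> J" for i
  proof -
    note [measurable] = assms(3)[OF that]
    show ?thesis using f e[OF that] by (intro integrable_mult_of_square_integrable) auto
  qed
  have int_ee: "integrable M (\<lambda>x. e i x * cnj (e j x))" if "i \<in> J" "j \<in> J" for i j
  proof -
    note [measurable] = assms(3)[OF that(1)] assms(3)[OF that(2)]
    show ?thesis using e[OF that(1)] e[OF that(2)]
      by (intro integrable_mult_of_square_integrable) auto
  qed
  have int_ff: "integrable M (\<lambda>x. f x * cnj (f x))"
    using f by (intro integrable_mult_of_square_integrable) auto
  have cnj_c: "(\<integral>x. cnj (f x) * e i x \<partial>M) = cnj (c i)" for i
    unfolding c_def by (subst Bochner_Integration.integral_cnj[symmetric]) simp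
  have expand: "complex_of_real ((cmod (f x - s x))\<^sup>2) =
      f x * cnj (f x) - (\<Sum>i\<in>J. c i * (cnj (f x) * e i x)) - (\<Sum>i\<in>J. cnj (c i) * (f x * cnj (e i x)))
        + (\<Sum>i\<in>J. \<Sum>j\<in>J. c i * cnj (c j) * (e i x * cnj (e j x)))" for x
  proof -
    have "complex_of_real ((cmod (f x - s x))\<^sup>2) = (f x - s x) * cnj (f x - s x)"
      by (rule complex_norm_square)
    also have "\<dots> = f x * cnj (f x) - cnj (f x) * s x - f x * cnj (s x) + s x * cnj (s x)"
      by (simp add: algebra_simps)
    also have "cnj (f x) * s x = (\<Sum>i\<in>J. c i * (cnj (f x) * e i x))"
      by (simp add: s_def sum_distrib_left algebra_simps)
    also have "f x * cnj (s x) = (\<Sum>i\<in>J. cnj (c i) * (f x * cnj (e i x)))"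
      by (simp add: s_def sum_distrib_left algebra_simps)
    also have "s x * cnj (s x) = (\<Sum>i\<in>J. \<Sum>j\<in>J. c i * cnj (c j) * (e i x * cnj (e j x)))"
      by (simp add: s_def sum_product algebra_simps)
    finally show ?thesis .
  qed
  have "complex_of_real (\<integral>x. (cmod (f x - s x))\<^sup>2 \<partial>M) =
      (\<integral>x. complex_of_real ((cmod (f x - s x))\<^sup>2) \<partial>M)"
    by (rule integral_complex_of_real[symmetric])
  also have "\<dots> = (\<integral>x. f x * cnj (f x) \<partial>M) - (\<Sum>i\<in>J. c i * cnj (c i)) - (\<Sum>i\<in>J. cnj (c i) * c i)
        + (\<Sum>i\<in>J. \<Sum>j\<in>J. c i * cnj (c j) * (if i = j then 1 else 0))"
    unfolding expand
    by (simp add: int_fe int_ef int_ee int_ff cnj_c c_def[symmetric] orth)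
  also have "\<dots> = (\<integral>x. f x * cnj (f x) \<partial>M) - (\<Sum>i\<in>J. c i * cnj (c i))"
    using \<open>finite J\<close> by (simp add: if_distrib mult.commute cong: if_cong)
  also have "\<dots> = complex_of_real ((\<integral>x. (cmod (f x))\<^sup>2 \<partial>M) - (\<Sum>i\<in>J. (cmod (c i))\<^sup>2))"
    by (simp flip: complex_norm_square integral_complex_of_real)
  finally have "(\<integral>x. (cmod (f x - s x))\<^sup>2 \<partial>M) = (\<integral>x. (cmod (f x))\<^sup>2 \<partial>M) - (\<Sum>i\<in>J. (cmod (c i))\<^sup>2)"
    by (simp only: of_real_eq_iff)
  moreover have "(\<integral>x. (cmod (f x - s x))\<^sup>2 \<partial>M) \<ge> 0"
    by simp
  ultimately show ?thesis
    by (simp add: c_def)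
qed

lemma integral_cis_period:
  fixes m :: int
  shows "(\<integral>t. indicator {0..1} t *\<^sub>R cis (2 * pi * m * t) \<partial>lborel) = (if m = 0 then 1 else 0)"
proof (cases "m = 0")
  case False
  define F where "F z = exp (2 * pi * \<i> * m * z) / (2 * pi * \<i> * m)" for z :: complex
  have "(F has_field_derivative exp (2 * pi * \<i> * m * z)) (at z)" for z
    unfolding F_def using False by (auto intro!: derivative_eq_intros)
  then have "((\<lambda>t. F (of_real t)) has_vector_derivative exp (2 * pi * \<i> * m * of_real t))
      (at t within {0..1})" for t :: real
    by (intro has_vector_derivative_real_field)
  then have "((\<lambda>t. F (of_real t)) has_vector_derivative cis (2 * pi * m * t)) (at t within {0..1})"
    for t :: real
    unfolding cis_conv_exp by (rule back_subst) (simp add: mult_ac)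
  then have "(\<integral>t. indicator {0..1} t *\<^sub>R cis (2 * pi * m * t) \<partial>lborel) = F (of_real 1) - F (of_real 0)"
    by (intro integral_FTC_Icc) (auto intro!: continuous_intros)
  also have "F (of_real 1) = F (of_real 0)"
    using cis_multiple_2pi[of "of_int m"] by (simp add: F_def cis_conv_exp mult_ac)
  finally show ?thesis using False by simp
qed simp

section \<open>The arc length measure of the square\<close>

text \<open>
  At the break points the neighbouring affine pieces agree, so the formula holds for every real \<open>t\<close>;
  outside the unit interval the first and the last piece are continued as lines.
\<close>

lemma square_path_eq:
  "square_path t = (if t \<le> 1/2 then 2 * t else 2 - 2 * t,
     if t \<le> 1/4 then 2 * t else if t \<le> 3/4 then 1 - 2 * t else 2 * t - 2)"
  by (auto simp: square_path_def joinpaths_def linepath_def field_simps)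

lemma measurable_square_path [measurable]: "square_path \<in> borel_measurable borel"
  unfolding square_path_eq[abs_def] by measurable

lemma norm_vector_derivative_square_path:
  assumes "t \<notin> {1/4, 1/2, 3/4}"
  shows "norm (vector_derivative square_path (at t)) = 2 * sqrt 2"
proof -
  have sqrt8: "sqrt 8 = 2 * sqrt 2"
    using real_sqrt_mult[of 4 2] by simp
  have local_affine: "vector_derivative square_path (at t) = v"
    if "\<And>s. s \<in> S \<Longrightarrow> square_path s = a + s *\<^sub>R v" "open S" "t \<in> S" for S a v
  proof -
    have "((\<lambda>s. a + s *\<^sub>R v) has_vector_derivative v) (at t)"
      by (auto intro!: derivative_eq_intros)
    then have "(square_path has_vector_derivative v) (at t)"
      using that by (elim has_vector_derivative_transform_within_open) auto
    then show ?thesis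
      by (rule vector_derivative_at)
  qed
  consider "t < 1/4" | "1/4 < t" "t < 1/2" | "1/2 < t" "t < 3/4" | "3/4 < t"
    using assms by force
  then show ?thesis
  proof cases
    case 1
    then have "vector_derivative square_path (at t) = (2, 2)"
      by (intro local_affine[of "{..<1/4}" "(0, 0)"]) (auto simp: square_path_eq)
    then show ?thesis by (simp add: norm_Pair sqrt8)
  next
    case 2
    then have "vector_derivative square_path (at t) = (2, -2)"
      by (intro local_affine[of "{1/4<..<1/2}" "(0, 1)"]) (auto simp: square_path_eq)
    then show ?thesis by (simp add: norm_Pair sqrt8)
  next
    case 3
    then have "vector_derivative square_path (at t) = (-2, -2)"
      by (intro local_affine[of "{1/2<..<3/4}" "(2, 1)"]) (auto simp: square_path_eq)
    then show ?thesis by (simp add: norm_Pair sqrt8)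
  next
    case 4
    then have "vector_derivative square_path (at t) = (-2, 2)"
      by (intro local_affine[of "{3/4<..}" "(2, -2)"]) (auto simp: square_path_eq)
    then show ?thesis by (simp add: norm_Pair sqrt8)
  qed
qed

text \<open>
  The path runs through each side in a quarter of the unit interval, hence with the constant
  speed \<open>2 * sqrt 2\<close>, four times the side length.
\<close>

lemma integral_arc_length_square:
  fixes f :: "real \<times> real \<Rightarrow> 'b::{banach, second_countable_topology}"
  assumes [measurable]: "f \<in> borel_measurable borel"
  shows "integral\<^sup>L (arc_length_measure square_path) f =
    (2 * sqrt 2) *\<^sub>R (\<integral>t. indicator {0..1} t *\<^sub>R f (square_path t) \<partial>lborel)"
proof -
  let ?v = "\<lambda>t. norm (vector_derivative square_path (at t))"
  have v_AE: "AE t in lborel. ?v t = 2 * sqrt 2"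
  proof (rule AE_mp)
    show "AE t in lborel. t \<notin> {1/4, 1/2, 3/4 :: real}"
      by (intro AE_not_in finite_imp_null_set_lborel) simp
  qed (use norm_vector_derivative_square_path in auto)
  \<comment> \<open>The AE statement alone does not make the speed Borel measurable; finiteness of the exceptional
    set does.\<close>
  have v_meas [measurable]: "?v \<in> borel_measurable borel"
    by (rule measurable_discrete_difference[where X = "{1/4, 1/2, 3/4}" and f = "\<lambda>_. 2 * sqrt 2"])
      (auto simp: norm_vector_derivative_square_path)
  have "integral\<^sup>L (arc_length_measure square_path) f =
      (\<integral>t. f (square_path t)
         \<partial>density (restrict_space lborel {0..1}) (\<lambda>t. ennreal (?v t)))"
    unfolding arc_length_measure_def
    by (rule integral_distr) (auto intro: measurable_restrict_space1)
  also have "\<dots> = (\<integral>t. ?v t *\<^sub>R f (square_path t) \<partial>restrict_space lborel {0..1})"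
    by (rule integral_density) (auto intro!: measurable_restrict_space1)
  also have "\<dots> = (\<integral>t. indicator {0..1} t *\<^sub>R ?v t *\<^sub>R f (square_path t) \<partial>lborel)"
    by (rule integral_restrict_space) simp
  also have "\<dots> = (\<integral>t. (2 * sqrt 2) *\<^sub>R indicator {0..1} t *\<^sub>R f (square_path t) \<partial>lborel)"
    by (rule integral_cong_AE) (use v_AE in auto)
  also have "\<dots> = (2 * sqrt 2) *\<^sub>R (\<integral>t. indicator {0..1} t *\<^sub>R f (square_path t) \<partial>lborel)"
    by (rule integral_scaleR_right)
  finally show ?thesis .
qed

section \<open>A function near the corner that every coset almost annihilates\<close>

lemma expo_eq_cis: "expo l x = cis (2 * pi * (l \<bullet> x))"
  by (simp add: expo_def cis_conv_exp mult_ac)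

lemma measurable_cis [measurable]: "cis \<in> borel_measurable borel"
  by (intro borel_measurable_continuous_onI continuous_intros)

lemma measurable_expo [measurable]: "expo l \<in> borel_measurable borel"
  unfolding expo_eq_cis[abs_def] by measurable

text \<open>
  With \<open>sgn\<close> the function vanishes at the corner, so that its pullback to the unit interval is exactly
  antisymmetric under \<open>t \<mapsto> 1 - t\<close>, which exchanges the two sides at the corner. The path reaches the
  first coordinate \<open>2 * \<delta>\<close> at the parameters \<open>\<delta>\<close> and \<open>1 - \<delta>\<close>.
\<close>

definition corner_jump :: "real \<Rightarrow> real \<times> real \<Rightarrow> complex" where
  "corner_jump \<delta> p = indicator {p. fst p \<le> 2 * \<delta>} p * of_real (sgn (snd p))"

lemma measurable_corner_jump [measurable]: "corner_jump \<delta> \<in> borel_measurable borel"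
  unfolding corner_jump_def[abs_def] borel_prod[symmetric] by measurable

lemma corner_jump_square_path:
  assumes "\<delta> \<le> 1/4" "t \<in> {0..1}"
  shows "corner_jump \<delta> (square_path t) =
    of_real (indicator {0<..\<delta>} t - indicator {1 - \<delta>..<1} t)"
  using assms by (auto simp: corner_jump_def square_path_eq indicator_def sgn_if)

lemma square_integral_corner_jump:
  assumes "0 < \<delta>" "\<delta> \<le> 1/4"
  shows "integrable (arc_length_measure square_path) (\<lambda>x. (cmod (corner_jump \<delta> x))\<^sup>2)"
    and "(\<integral>x. (cmod (corner_jump \<delta> x))\<^sup>2 \<partial>arc_length_measure square_path) = 4 * sqrt 2 * \<delta>"
proof -
  have "(\<integral>x. (cmod (corner_jump \<delta> x))\<^sup>2 \<partial>arc_length_measure square_path) =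
     2 * sqrt 2 * (\<integral>t. indicator {0..1} t *\<^sub>R (cmod (corner_jump \<delta> (square_path t)))\<^sup>2 \<partial>lborel)"
    by (subst integral_arc_length_square) auto
  also have "(\<integral>t. indicator {0..1} t *\<^sub>R (cmod (corner_jump \<delta> (square_path t)))\<^sup>2 \<partial>lborel) =
      (\<integral>t. indicator {0<..\<delta>} t + indicator {1 - \<delta>..<1} t \<partial>lborel)"
  proof (rule Bochner_Integration.integral_cong)
    fix t :: real
    show "indicator {0..1} t *\<^sub>R (cmod (corner_jump \<delta> (square_path t)))\<^sup>2 =
        indicator {0<..\<delta>} t + (indicator {1 - \<delta>..<1} t :: real)"
    proof (cases "t \<in> {0..1}")
      case True
      then show ?thesis
        using assms unfolding corner_jump_square_path[OF assms(2) True] norm_of_real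
        by (auto simp: indicator_def)
    qed (use assms in \<open>auto simp: indicator_def\<close>)
  qed simp
  also have "\<dots> = 2 * \<delta>"
    using assms by simp
  finally show eq: "(\<integral>x. (cmod (corner_jump \<delta> x))\<^sup>2 \<partial>arc_length_measure square_path) = 4 * sqrt 2 * \<delta>"
    by simp
  \<comment> \<open>A function that is not integrable has integral 0.\<close>
  show "integrable (arc_length_measure square_path) (\<lambda>x. (cmod (corner_jump \<delta> x))\<^sup>2)"
    using eq assms not_integrable_integral_eq[of "arc_length_measure square_path"] by fastforce
qed

text \<open>
  The integrand of the coefficient at \<open>(a, b)\<close> of \<open>corner_jump \<delta>\<close>, pulled back to the unit interval,
  multiplied by the speed and folded along \<open>t \<mapsto> 1 - t\<close>. The two summands of the difference come from
  the upper and the lower side.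
\<close>

definition folded_jump :: "real \<Rightarrow> real \<Rightarrow> real \<Rightarrow> real \<Rightarrow> complex" where
  "folded_jump \<delta> a b t = indicator {0<..\<delta>} t *\<^sub>R
     (2 * sqrt 2 * cis (- 4 * pi * a * t) * (cis (- 4 * pi * b * t) - cis (4 * pi * b * t)))"

text \<open>
  On the two sides at the corner the first coordinate is \<open>2 t\<close> and \<open>2 (1 - t)\<close>, respectively, so
  after folding the integer \<open>n\<close> contributes the common factor \<open>cis (- 4 \<pi> n t)\<close>. Therefore the
  coefficients along a coset are Fourier coefficients on the unit interval at the even
  frequencies \<open>2 n\<close>.
\<close>

lemma corner_jump_coefficient:
  assumes "0 < \<delta>" "\<delta> \<le> 1/4"
  shows "(\<integral>x. corner_jump \<delta> x * expo (- ((of_int n, 0) + (a, b))) x \<partial>arc_length_measure square_path) =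
    (\<integral>t. folded_jump \<delta> a b t * cnj (indicator {0..1} t *\<^sub>R cis (2 * pi * of_int (2 * n) * t)) \<partial>lborel)"
proof -
  let ?E = "expo (- ((of_int n, 0) + (a, b)))"
  \<comment> \<open>For \<open>0 < t \<le> \<delta>\<close>, the values of the conjugate character at the points of the upper and the
    lower side with first coordinate \<open>2 t\<close>.\<close>
  define u where "u t = cis (- 4 * pi * (n + a) * t - 4 * pi * b * t)" for t
  define v where "v t = cis (- 4 * pi * (n + a) * t + 4 * pi * b * t)" for t
  have [measurable]: "u \<in> borel_measurable borel" "v \<in> borel_measurable borel"
    unfolding u_def[abs_def] v_def[abs_def] by measurable
  have int: "integrable lborel (\<lambda>t. indicator I t *\<^sub>R w t)"
    if [measurable]: "w \<in> borel_measurable borel" and "\<And>t. cmod (w t) = 1"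
      and I: "integrable lborel (indicator I :: real \<Rightarrow> real)" for I and w :: "real \<Rightarrow> complex"
  proof (rule Bochner_Integration.integrable_bound[OF I])
    have [measurable]: "(indicator I :: real \<Rightarrow> real) \<in> borel_measurable borel"
      using borel_measurable_integrable[OF I] by simp
    show "(\<lambda>t. indicator I t *\<^sub>R w t) \<in> borel_measurable lborel"
      by simp
  qed (simp add: that)
  have cmod_uv: "cmod (u t) = 1" "cmod (v t) = 1" for t
    by (simp_all add: u_def v_def)
  have split: "indicator {0..1} t *\<^sub>R (corner_jump \<delta> (square_path t) * ?E (square_path t)) =
      indicator {0<..\<delta>} t *\<^sub>R u t - indicator {1 - \<delta>..<1} t *\<^sub>R v (1 - t)" for t
  proof (cases "t \<in> {0..1}")
    case True
    consider "t \<in> {0<..\<delta>}" | "t \<in> {1 - \<delta>..<1}" | "t \<notin> {0<..\<delta>}" "t \<notin> {1 - \<delta>..<1}"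
      by blast
    then show ?thesis
    proof cases
      case 1
      then have "?E (square_path t) = u t"
        using assms by (simp add: expo_eq_cis square_path_eq u_def algebra_simps)
      then show ?thesis
        using assms 1 True by (auto simp: corner_jump_square_path indicator_def)
    next
      case 2
      then have "square_path t = (2 - 2 * t, 2 * t - 2)"
        using assms by (auto simp: square_path_eq)
      then have "?E (square_path t) = v (1 - t)"
        by (simp add: expo_eq_cis v_def algebra_simps)
      then show ?thesis
        using assms 2 True by (auto simp: corner_jump_square_path indicator_def)
    qed (use assms True in \<open>auto simp: corner_jump_square_path indicator_def\<close>)
  qed (use assms in \<open>auto simp: indicator_def\<close>)
  have "(\<integral>x. corner_jump \<delta> x * ?E x \<partial>arc_length_measure square_path) =
      (2 * sqrt 2) *\<^sub>R (\<integral>t. indicator {0<..\<delta>} t *\<^sub>R u t - indicator {1 - \<delta>..<1} t *\<^sub>R v (1 - t) \<partial>lborel)"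
    by (subst integral_arc_length_square)
      (auto simp only: split intro: borel_measurable_times measurable_expo measurable_corner_jump)
  also have "(\<integral>t. indicator {0<..\<delta>} t *\<^sub>R u t - indicator {1 - \<delta>..<1} t *\<^sub>R v (1 - t) \<partial>lborel) =
      (\<integral>t. indicator {0<..\<delta>} t *\<^sub>R u t \<partial>lborel) - (\<integral>t. indicator {1 - \<delta>..<1} t *\<^sub>R v (1 - t) \<partial>lborel)"
    by (intro Bochner_Integration.integral_diff int) (use assms in \<open>simp_all add: cmod_uv\<close>)
  also have "(\<integral>t. indicator {1 - \<delta>..<1} t *\<^sub>R v (1 - t) \<partial>lborel) =
      (\<integral>t. indicator {1 - \<delta>..<1} (1 - t) *\<^sub>R v t \<partial>lborel)"
    by (subst lborel_integral_real_affine[of "-1" _ 1]) auto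
  also have "\<dots> = (\<integral>t. indicator {0<..\<delta>} t *\<^sub>R v t \<partial>lborel)"
    by (intro Bochner_Integration.integral_cong) (auto simp: indicator_def)
  also have "(\<integral>t. indicator {0<..\<delta>} t *\<^sub>R u t \<partial>lborel) - (\<integral>t. indicator {0<..\<delta>} t *\<^sub>R v t \<partial>lborel) =
      (\<integral>t. indicator {0<..\<delta>} t *\<^sub>R (u t - v t) \<partial>lborel)"
    by (subst Bochner_Integration.integral_diff[symmetric])
      (use assms in \<open>auto intro!: int simp: cmod_uv scaleR_diff_right\<close>)
  also have "(2 * sqrt 2) *\<^sub>R \<dots> = (\<integral>t. (2 * sqrt 2) *\<^sub>R indicator {0<..\<delta>} t *\<^sub>R (u t - v t) \<partial>lborel)"
    by (rule integral_scaleR_right[symmetric])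
  also have "\<dots> = (\<integral>t. folded_jump \<delta> a b t * cnj (indicator {0..1} t *\<^sub>R cis (2 * pi * of_int (2 * n) * t)) \<partial>lborel)"
  proof (rule Bochner_Integration.integral_cong)
    fix t :: real
    have "u t = cis (- 4 * pi * a * t) * cis (- 4 * pi * b * t) * cis (- (4 * pi * n * t))"
      "v t = cis (- 4 * pi * a * t) * cis (4 * pi * b * t) * cis (- (4 * pi * n * t))"
      by (simp_all add: u_def v_def cis_mult algebra_simps)
    then show "(2 * sqrt 2) *\<^sub>R indicator {0<..\<delta>} t *\<^sub>R (u t - v t) =
        folded_jump \<delta> a b t * cnj (indicator {0..1} t *\<^sub>R cis (2 * pi * of_int (2 * n) * t))"
      using assms by (auto simp: folded_jump_def indicator_def cis_cnj algebra_simps scaleR_conv_of_real)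
  qed simp
  finally show ?thesis .
qed

text \<open>
  The contributions of the two sides differ by \<open>- 2 \<i> sin (4 \<pi> b t)\<close>, which is small for small \<open>t\<close>. Since
  \<open>n\<close> has been split off, the bound is the same for the whole coset.
\<close>

lemma norm_folded_jump_squared_le:
  "(cmod (folded_jump \<delta> a b t))\<^sup>2 \<le> 512 * pi\<^sup>2 * b\<^sup>2 * \<delta>\<^sup>2 * indicator {0<..\<delta>} t"
proof (cases "t \<in> {0<..\<delta>}")
  case True
  have *: "cis (- 4 * pi * b * t) - cis (4 * pi * b * t) = - (2 * \<i> * sin (4 * pi * b * t))"
    by (simp add: complex_eq_iff)
  have "(cmod (folded_jump \<delta> a b t))\<^sup>2 = 32 * (sin (4 * pi * b * t))\<^sup>2"
    using True by (simp only: folded_jump_def * norm_mult norm_scaleR) (simp add: norm_mult power_mult_distrib)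
  also have "(sin (4 * pi * b * t))\<^sup>2 \<le> (4 * pi * b * t)\<^sup>2"
    using abs_sin_x_le_abs_x by (simp add: abs_le_square_iff[symmetric])
  also have "\<dots> \<le> (4 * pi * b * \<delta>)\<^sup>2"
    using True by (auto simp: power_mult_distrib intro!: mult_left_mono power_mono)
  finally show ?thesis
    using True by (simp add: power_mult_distrib)
qed (simp add: folded_jump_def)

text \<open>
  In Bessel's inequality the pointwise bound contributes \<open>\<delta>\<^sup>2\<close> and the length of the support a third
  factor \<open>\<delta>\<close>. Orthonormality on the unit interval holds for all integer frequencies, hence for the
  even ones.
\<close>

lemma corner_jump_coset_sum_le:
  assumes "0 < \<delta>" "\<delta> \<le> 1/4" and "finite F" "F \<subseteq> (\<lambda>x. x + p) ` (\<int> \<times> {0})"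
  shows "(\<Sum>l\<in>F. (cmod (\<integral>x. corner_jump \<delta> x * expo (- l) x \<partial>arc_length_measure square_path))\<^sup>2)
    \<le> 512 * pi\<^sup>2 * (snd p)\<^sup>2 * \<delta> ^ 3"
proof -
  obtain a b where p: "p = (a, b)" by fastforce
  let ?e = "\<lambda>(n::int) t::real. indicator {0..1} t *\<^sub>R cis (2 * pi * of_int (2 * n) * t)"
  let ?l = "\<lambda>n::int. (of_int n, 0) + (a, b)"
  have [measurable]: "folded_jump \<delta> a b \<in> borel_measurable borel" "?e n \<in> borel_measurable borel" for n
    unfolding folded_jump_def[abs_def] by measurable
  have bound: "integrable lborel (\<lambda>t::real. 512 * pi\<^sup>2 * b\<^sup>2 * \<delta>\<^sup>2 * indicator {0<..\<delta>} t)"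
    using assms by simp
  have int: "integrable lborel (\<lambda>t. (cmod (folded_jump \<delta> a b t))\<^sup>2)"
    by (rule Bochner_Integration.integrable_bound[OF bound])
      (use norm_folded_jump_squared_le in \<open>auto intro: order_trans[OF _ abs_ge_self]\<close>)
  have "F \<subseteq> range ?l"
  proof
    fix l assume "l \<in> F"
    then obtain z where z: "z \<in> \<int>" "l = (z, 0) + (a, b)"
      using assms(4) p by blast
    then obtain n :: int where "z = of_int n"
      by (elim Ints_cases)
    with z show "l \<in> range ?l"
      by (intro image_eqI[of _ _ n]) simp_all
  qed
  then obtain J where J: "finite J" "F = ?l ` J"
    using \<open>finite F\<close> by (meson finite_subset_image)
  have "(\<Sum>l\<in>F. (cmod (\<integral>x. corner_jump \<delta> x * expo (- l) x \<partial>arc_length_measure square_path))\<^sup>2)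
      = (\<Sum>n\<in>J. (cmod (\<integral>t. folded_jump \<delta> a b t * cnj (?e n t) \<partial>lborel))\<^sup>2)"
    unfolding J(2) by (subst sum.reindex) (auto simp: inj_on_def corner_jump_coefficient[OF assms(1,2), simplified])
  also have "\<dots> \<le> (\<integral>t. (cmod (folded_jump \<delta> a b t))\<^sup>2 \<partial>lborel)"
  proof (rule Bessel_inequality)
    fix m n :: int
    have "(cmod (?e n t))\<^sup>2 = indicator {0..1} t" for t
      by (simp add: indicator_def)
    then show "integrable lborel (\<lambda>t. (cmod (?e n t))\<^sup>2)"
      by simp
    have "(\<integral>t. ?e m t * cnj (?e n t) \<partial>lborel) =
        (\<integral>t. indicator {0..1} t *\<^sub>R cis (2 * pi * of_int (2 * m - 2 * n) * t) \<partial>lborel)"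
      by (intro Bochner_Integration.integral_cong) (auto simp: indicator_def cis_cnj cis_mult algebra_simps)
    then show "(\<integral>t. ?e m t * cnj (?e n t) \<partial>lborel) = (if m = n then 1 else 0)"
      by (subst (asm) integral_cis_period) simp
  qed (use J int in auto)
  also have "\<dots> \<le> (\<integral>t. 512 * pi\<^sup>2 * b\<^sup>2 * \<delta>\<^sup>2 * indicator {0<..\<delta>} t \<partial>lborel)"
    by (intro integral_mono int bound norm_folded_jump_squared_le)
  also have "\<dots> = 512 * pi\<^sup>2 * (snd p)\<^sup>2 * \<delta> ^ 3"
    using assms by (simp add: p power3_eq_cube power2_eq_square)
  finally show ?thesis .
qed

section \<open>Finitely many cosets never give a frame\<close>

lemma sum_subset_UN_le:
  fixes f :: "'a \<Rightarrow> real"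
  assumes "finite K" "finite F" "F \<subseteq> (\<Union>k\<in>K. A k)" "\<And>x. f x \<ge> 0"
  shows "sum f F \<le> (\<Sum>k\<in>K. sum f (F \<inter> A k))"
proof -
  have "f x \<le> (\<Sum>k\<in>K. if x \<in> A k then f x else 0)" if "x \<in> F" for x
  proof -
    obtain k where "k \<in> K" "x \<in> A k" using assms(3) \<open>x \<in> F\<close> by blast
    then show ?thesis
      using member_le_sum[of k K "\<lambda>k. if x \<in> A k then f x else 0"] assms by simp
  qed
  then have "sum f F \<le> (\<Sum>x\<in>F. \<Sum>k\<in>K. if x \<in> A k then f x else 0)"
    by (rule sum_mono)
  also have "\<dots> = (\<Sum>k\<in>K. sum f (F \<inter> A k))"
    using \<open>finite F\<close> by (subst sum.swap) (simp add: sum.inter_restrict)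
  finally show ?thesis .
qed

text \<open>
  The test function has squared norm of order \<open>\<delta>\<close> but coefficients with square sum of order
  \<open>\<delta>\<^sup>3\<close>; letting \<open>\<delta>\<close> be small excludes every lower bound \<open>A\<close>. The translates enter only
  through the constant \<open>C\<close>.
\<close>

lemma not_exp_frame_finite_cosets:
  fixes t :: "'k \<Rightarrow> real \<times> real"
  assumes "finite K"
  shows "\<not> exp_frame (arc_length_measure square_path) (\<Union>k\<in>K. (\<lambda>x. x + t k) ` (\<int> \<times> {0}))"
    (is "\<not> exp_frame ?\<mu> (\<Union>k\<in>K. ?A k)")
proof
  assume "exp_frame ?\<mu> (\<Union>k\<in>K. ?A k)"
  then obtain A where "A > 0" and frame: "\<And>f :: real \<times> real \<Rightarrow> complex.
      f \<in> borel_measurable ?\<mu> \<Longrightarrow> integrable ?\<mu> (\<lambda>x. (cmod (f x))\<^sup>2) \<Longrightarrow>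
      (\<lambda>l. (cmod (\<integral>x. f x * expo (- l) x \<partial>?\<mu>))\<^sup>2) summable_on (\<Union>k\<in>K. ?A k) \<and>
      A * (\<integral>x. (cmod (f x))\<^sup>2 \<partial>?\<mu>) \<le>
        (\<Sum>\<^sub>\<infinity>l\<in>(\<Union>k\<in>K. ?A k). (cmod (\<integral>x. f x * expo (- l) x \<partial>?\<mu>))\<^sup>2)"
    unfolding exp_frame_def by blast
  define C where "C = (\<Sum>k\<in>K. 512 * pi\<^sup>2 * (snd (t k))\<^sup>2)"
  have "C \<ge> 0" by (simp add: C_def sum_nonneg)
  \<comment> \<open>For \<open>\<delta> \<le> 1/4\<close> the test function sees only the two sides at the corner; the other bound yields
    \<open>C \<delta> \<le> A\<close>. Adding 1 covers the case \<open>C = 0\<close>.\<close>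
  define \<delta> where "\<delta> = min (1/4) (A / (C + 1))"
  have \<delta>_le: "\<delta> \<le> 1/4 \<and> \<delta> \<le> A / (C + 1)"
    unfolding \<delta>_def by linarith
  have "\<delta> > 0"
    using \<open>A > 0\<close> \<open>C \<ge> 0\<close> by (simp add: \<delta>_def)
  note \<delta> = \<open>\<delta> > 0\<close> \<delta>_le[THEN conjunct1] \<delta>_le[THEN conjunct2]
  let ?c = "\<lambda>l. (cmod (\<integral>x. corner_jump \<delta> x * expo (- l) x \<partial>?\<mu>))\<^sup>2"
  have "sets ?\<mu> = sets borel"
    by (simp add: arc_length_measure_def)
  then have meas: "corner_jump \<delta> \<in> borel_measurable ?\<mu>"
    using measurable_corner_jump by (simp cong: measurable_cong_sets)
  note frame_jump = frame[OF meas square_integral_corner_jump(1)[OF \<delta>(1,2)]]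
  have "A * (4 * sqrt 2 * \<delta>) \<le> (\<Sum>\<^sub>\<infinity>l\<in>(\<Union>k\<in>K. ?A k). ?c l)"
    using frame_jump square_integral_corner_jump(2)[OF \<delta>(1,2)] by simp
  also have "\<dots> \<le> C * \<delta> ^ 3"
  proof (rule infsum_le_finite_sums)
    fix F assume F: "finite F" "F \<subseteq> (\<Union>k\<in>K. ?A k)"
    have "sum ?c F \<le> (\<Sum>k\<in>K. sum ?c (F \<inter> ?A k))"
      by (rule sum_subset_UN_le) (use F assms in auto)
    also have "\<dots> \<le> (\<Sum>k\<in>K. 512 * pi\<^sup>2 * (snd (t k))\<^sup>2 * \<delta> ^ 3)"
      by (intro sum_mono corner_jump_coset_sum_le) (use \<delta> F in auto)
    finally show "sum ?c F \<le> C * \<delta> ^ 3"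
      by (simp add: C_def sum_distrib_right)
  qed (use frame_jump in simp)
  also have "C * \<delta> ^ 3 = (C * \<delta>) * \<delta> * \<delta>"
    by (simp add: power3_eq_cube)
  also have "\<dots> \<le> A * 1 * \<delta>"
  proof (intro mult_mono)
    have "C * \<delta> \<le> (C + 1) * (A / (C + 1))"
      using \<delta> \<open>C \<ge> 0\<close> by (intro mult_mono) auto
    then show "C * \<delta> \<le> A" using \<open>C \<ge> 0\<close> by simp
  qed (use \<delta> \<open>A > 0\<close> \<open>C \<ge> 0\<close> in auto)
  finally have "A * \<delta> * (4 * sqrt 2) \<le> A * \<delta> * 1"
    by (simp add: mult_ac)
  then have "4 * sqrt 2 \<le> 1"
    using \<open>A > 0\<close> \<delta>(1) by (subst (asm) mult_le_cancel_left_pos) auto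
  moreover have "sqrt 2 > 1" by simp
  ultimately show False by linarith
qed

theorem theorem1p2:
  shows "\<not> (\<exists>(N::nat) (t :: nat \<Rightarrow> real \<times> real). N \<ge> 1 \<and>
           exp_riesz_basis (arc_length_measure square_path)
             (\<Union>k\<in>{1..N}. (\<lambda>x. x + t k) ` (\<int> \<times> {0})))"
  using not_exp_frame_finite_cosets[OF finite_atLeastAtMost] unfolding exp_riesz_basis_def by blast

end
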